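(* Let $T$ be a computable tree (viewed as a partial order) in which at least one node has infinitely many immediate successors. Then $T$ has a punctual presentation, i.e. there is a tree $A\cong T$ with domain $\omega$ whose order relation is primitive recursive.
   Context: A tree is a partial order with a least element (the root) in which the set of predecessors of every node is a finite linear order. A node $b$ is an (immediate) successor of $a$ if $a<b$ and there is no $c$ with $a<c<b$. A computable tree is one with domain $\omega$ (or a computable subset of it) and computable order relation. *)

theory Defs
  imports Main
begin

text \<open>
  Functions of \<open>n\<close> arguments are represented as functions on lists, of which only the values
  on lists of length \<open>n\<close> matter. In primitive recursion the head of the list is the recursion
  argument, and in minimization it is the variable minimized over.
\<close>

inductive prim_rec :: "nat \<Rightarrow> (nat list \<Rightarrow> nat) \<Rightarrow> bool" where
  zero: "prim_rec n (\<lambda>xs. 0)"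
| succ: "prim_rec 1 (\<lambda>xs. Suc (xs ! 0))"
| proj: "i < n \<Longrightarrow> prim_rec n (\<lambda>xs. xs ! i)"
| comp: "prim_rec (length gs) f \<Longrightarrow> (\<And>g. g \<in> set gs \<Longrightarrow> prim_rec n g) \<Longrightarrow>
    prim_rec n (\<lambda>xs. f (map (\<lambda>g. g xs) gs))"
| prec: "prim_rec n f \<Longrightarrow> prim_rec (Suc (Suc n)) g \<Longrightarrow>
    prim_rec (Suc n) (\<lambda>xs. rec_nat (f (tl xs)) (\<lambda>k v. g (k # v # tl xs)) (hd xs))"

definition mu :: "(nat list \<Rightarrow> nat option) \<Rightarrow> nat list \<Rightarrow> nat option" where
  "mu f xs =
    (if \<exists>k. f (k # xs) = Some 0 \<and> (\<forall>j<k. f (j # xs) \<noteq> None)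
     then Some (LEAST k. f (k # xs) = Some 0)
     else None)"

text \<open>Partial functions, with \<^const>\<open>None\<close> for \<open>undefined\<close>; all operations are strict.\<close>

inductive partial_rec :: "nat \<Rightarrow> (nat list \<Rightarrow> nat option) \<Rightarrow> bool" where
  zero: "partial_rec n (\<lambda>xs. Some 0)"
| succ: "partial_rec 1 (\<lambda>xs. Some (Suc (xs ! 0)))"
| proj: "i < n \<Longrightarrow> partial_rec n (\<lambda>xs. Some (xs ! i))"
| comp: "partial_rec (length gs) f \<Longrightarrow> (\<And>g. g \<in> set gs \<Longrightarrow> partial_rec n g) \<Longrightarrow>
    partial_rec n (\<lambda>xs. Option.bind (those (map (\<lambda>g. g xs) gs)) f)"
| prec: "partial_rec n f \<Longrightarrow> partial_rec (Suc (Suc n)) g \<Longrightarrow>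
    partial_rec (Suc n)
      (\<lambda>xs. rec_nat (f (tl xs)) (\<lambda>k w. Option.bind w (\<lambda>v. g (k # v # tl xs))) (hd xs))"
| mu: "partial_rec (Suc n) f \<Longrightarrow> partial_rec n (mu f)"

definition computable_set :: "nat set \<Rightarrow> bool" where
  "computable_set D \<longleftrightarrow>
    (\<exists>f. partial_rec 1 f \<and> (\<forall>x. f [x] = Some (if x \<in> D then 1 else 0)))"

definition computable_rel :: "nat rel \<Rightarrow> bool" where
  "computable_rel r \<longleftrightarrow>
    (\<exists>f. partial_rec 2 f \<and> (\<forall>x y. f [x, y] = Some (if (x, y) \<in> r then 1 else 0)))"

definition prim_rec_rel :: "nat rel \<Rightarrow> bool" where
  "prim_rec_rel r \<longleftrightarrow>
    (\<exists>f. prim_rec 2 f \<and> (\<forall>x y. f [x, y] = (if (x, y) \<in> r then 1 else 0)))"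

text \<open>
  A tree is given by its domain and its reflexive order. Note that \<^const>\<open>partial_order_on\<close>
  includes \<open>r \<subseteq> D \<times> D\<close>, and that \<open>underS r a\<close> is the set of strict predecessors of \<open>a\<close>.
\<close>

definition tree :: "'a set \<Rightarrow> 'a rel \<Rightarrow> bool" where
  "tree D r \<longleftrightarrow> partial_order_on D r \<and>
    (\<exists>root\<in>D. \<forall>x\<in>D. (root, x) \<in> r) \<and>
    (\<forall>a\<in>D. finite (underS r a) \<and> linear_order_on (underS r a) (Restr r (underS r a)))"

definition immediate_successors :: "'a rel \<Rightarrow> 'a \<Rightarrow> 'a set" where
  "immediate_successors r a =
    {b. (a, b) \<in> r - Id \<and> (\<nexists>c. (a, c) \<in> r - Id \<and> (c, b) \<in> r - Id)}"

definition order_isomorphic :: "'a set \<Rightarrow> 'a rel \<Rightarrow> 'b set \<Rightarrow> 'b rel \<Rightarrow> bool" where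
  "order_isomorphic A r B s \<longleftrightarrow>
    (\<exists>f. bij_betw f A B \<and> (\<forall>x\<in>A. \<forall>y\<in>A. (x, y) \<in> r \<longleftrightarrow> (f x, f y) \<in> s))"

definition computable_tree :: "nat set \<Rightarrow> nat rel \<Rightarrow> bool" where
  "computable_tree D r \<longleftrightarrow> tree D r \<and> computable_set D \<and> computable_rel r"

definition punctual_presentation :: "nat rel \<Rightarrow> 'a set \<Rightarrow> 'a rel \<Rightarrow> bool" where
  "punctual_presentation s D r \<longleftrightarrow>
    tree UNIV s \<and> prim_rec_rel s \<and> order_isomorphic UNIV s D r"

end

theory Submission
  imports Defs
begin

text \<open>
  Let \<open>a\<close> have infinitely many immediate successors. Their cones are disjoint, so for every finite
  set of nodes not below \<open>a\<close> some \<open>b\<close> above \<open>a\<close> is incomparable to all of them; unbounded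
  search yields a computable increasing antichain \<open>J 0, J 1, \<dots>\<close> above \<open>a\<close>, with computable range,
  such that \<open>J i\<close> is incomparable to every \<open>d < i\<close> not below \<open>a\<close>. The presentation puts a node at
  every stage \<open>t\<close>. As long as the relations of the next node \<open>d\<close> outside this antichain to the
  earlier nodes and to \<open>J 0, \<dots>, J d\<close> have not been computed, the new node is a filler, which will
  turn out to be the next \<open>J i\<close>; otherwise it is \<open>d\<close>. The relation between
  \<open>d\<close> and a filler \<open>J i\<close> is either already computed, if \<open>i \<le> d\<close>, or forced: \<open>d\<close> is below \<open>J i\<close> if
  and only if it is one of the finitely many nodes below \<open>a\<close>. So no unbounded search is ever needed
  to decide the order.
\<close>

section \<open>Classes of functions closed under primitive recursion\<close>

text \<open>One set of closure lemmas serves both primitive recursive and total recursive functions.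
  The assumption \<open>ext\<close> reflects that only values on lists of length \<open>n\<close>
  matter.\<close>

locale rec_closed =
  fixes C :: "nat \<Rightarrow> (nat list \<Rightarrow> nat) \<Rightarrow> bool"
  assumes ext: "\<lbrakk>C n f; \<And>xs. length xs = n \<Longrightarrow> f xs = g xs\<rbrakk> \<Longrightarrow> C n g"
    and zero: "C n (\<lambda>xs. 0)"
    and succ: "C (Suc 0) (\<lambda>xs. Suc (xs ! 0))"
    and proj: "i < n \<Longrightarrow> C n (\<lambda>xs. xs ! i)"
    and comp: "\<lbrakk>C (length gs) f; \<And>g. g \<in> set gs \<Longrightarrow> C n g\<rbrakk> \<Longrightarrow> C n (\<lambda>xs. f (map (\<lambda>g. g xs) gs))"
    and prec: "\<lbrakk>C n f; C (Suc (Suc n)) g\<rbrakk> \<Longrightarrow>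
      C (Suc n) (\<lambda>xs. rec_nat (f (tl xs)) (\<lambda>k v. g (k # v # tl xs)) (hd xs))"
begin

lemma comp1: "\<lbrakk>C (Suc 0) (\<lambda>xs. h (xs ! 0)); C n f\<rbrakk> \<Longrightarrow> C n (\<lambda>xs. h (f xs))"
  using comp[of "[f]" "\<lambda>xs. h (xs ! 0)" n] by simp

lemma comp2:
  "\<lbrakk>C (Suc (Suc 0)) (\<lambda>xs. h (xs ! 0) (xs ! 1)); C n f; C n g\<rbrakk> \<Longrightarrow> C n (\<lambda>xs. h (f xs) (g xs))"
  using comp[of "[f, g]" "\<lambda>xs. h (xs ! 0) (xs ! 1)" n] by auto

lemma comp3:
  "\<lbrakk>C (Suc (Suc (Suc 0))) (\<lambda>xs. h (xs ! 0) (xs ! 1) (xs ! 2)); C n f; C n g; C n k\<rbrakk> \<Longrightarrow>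
    C n (\<lambda>xs. h (f xs) (g xs) (k xs))"
  using comp[of "[f, g, k]" "\<lambda>xs. h (xs ! 0) (xs ! 1) (xs ! 2)" n] by auto

text \<open>Composition names every argument by a function, so passing the remaining parameters
  \<open>drop k xs\<close> along takes one projection for each of them.\<close>

lemma comp_drop:
  assumes f: "C (length gs + n) f" and gs: "\<forall>g\<in>set gs. C (k + n) g"
  shows "C (k + n) (\<lambda>xs. f (map (\<lambda>g. g xs) gs @ drop k xs))"
proof -
  have "C (k + n) (\<lambda>xs. f (map (\<lambda>g. g xs) (gs @ map (\<lambda>i xs. xs ! (k + i)) [0..<n])))"
    using f gs by (intro comp) (auto intro: proj)
  then show ?thesis
  proof (rule ext)
    fix xs :: "nat list"
    assume "length xs = k + n"
    then have "map (\<lambda>i. xs ! (k + i)) [0..<n] = drop k xs"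
      by (intro nth_equalityI) auto
    then show "f (map (\<lambda>g. g xs) (gs @ map (\<lambda>i xs. xs ! (k + i)) [0..<n])) =
        f (map (\<lambda>g. g xs) gs @ drop k xs)"
      by (simp add: comp_def)
  qed
qed

lemma comp_tl: "C n f \<Longrightarrow> C (Suc n) (\<lambda>xs. f (tl xs))"
  using comp_drop[of "[]" n f 1] by (simp add: drop_Suc)

lemma proj_tl: "i < n \<Longrightarrow> C (Suc n) (\<lambda>xs. tl xs ! i)"
  by (intro comp_tl proj)

lemma proj_tl_tl: "i < n \<Longrightarrow> C (Suc (Suc n)) (\<lambda>xs. tl (tl xs) ! i)"
  by (rule comp_tl) (rule proj_tl)

lemma Suc: "C n f \<Longrightarrow> C n (\<lambda>xs. Suc (f xs))"
  using comp1[OF succ] .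

lemma const: "C n (\<lambda>xs. k)"
  by (induction k) (auto intro: zero Suc)

text \<open>\<open>prec\<close> recurses on the head of its argument list, so a composition prepends
  the bound \<open>k xs\<close> to \<open>xs\<close>. The step then sees the parameters behind
  counter and accumulator, at \<open>tl (tl xs)\<close>.\<close>

lemma rec:
  assumes b: "C n b" and s: "C (Suc (Suc n)) (\<lambda>xs. s (xs ! 0) (xs ! 1) (tl (tl xs)))" and k: "C n k"
  shows "C n (\<lambda>xs. rec_nat (b xs) (\<lambda>i v. s i v xs) (k xs))"
proof -
  have "C n (\<lambda>xs. (\<lambda>xs. rec_nat (b (tl xs)) (\<lambda>i v. s i v (tl xs)) (hd xs)) (map (\<lambda>g. g xs) [k] @ xs))"
    using comp_drop[of "[k]" n "\<lambda>xs. rec_nat (b (tl xs)) (\<lambda>i v. s i v (tl xs)) (hd xs)" 0] prec[OF b s] k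
    by simp
  then show ?thesis by simp
qed

lemma pred: "C n f \<Longrightarrow> C n (\<lambda>xs. f xs - 1)"
proof -
  assume f: "C n f"
  have "C n (\<lambda>xs. rec_nat 0 (\<lambda>i v. i) (f xs))"
    by (intro rec const proj f) auto
  moreover have "rec_nat 0 (\<lambda>i v. i) m = m - 1" for m
    by (cases m) auto
  ultimately show ?thesis by simp
qed

lemma add: "\<lbrakk>C n f; C n g\<rbrakk> \<Longrightarrow> C n (\<lambda>xs. f xs + g xs)"
proof -
  assume f: "C n f" and g: "C n g"
  have "C n (\<lambda>xs. rec_nat (f xs) (\<lambda>i v. Suc v) (g xs))"
    by (intro rec Suc proj f g) auto
  moreover have "rec_nat a (\<lambda>i v. Suc v) m = a + m" for a m
    by (induction m) auto
  ultimately show ?thesis by simp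
qed

lemma mult: "\<lbrakk>C n f; C n g\<rbrakk> \<Longrightarrow> C n (\<lambda>xs. f xs * g xs)"
proof -
  assume f: "C n f" and g: "C n g"
  have "C n (\<lambda>xs. rec_nat 0 (\<lambda>i v. v + f xs) (g xs))"
    by (intro rec const add proj g comp_tl f) auto
  moreover have "rec_nat 0 (\<lambda>i v. v + a) m = a * m" for a m :: nat
    by (induction m) auto
  ultimately show ?thesis by simp
qed

lemma diff: "\<lbrakk>C n f; C n g\<rbrakk> \<Longrightarrow> C n (\<lambda>xs. f xs - g xs)"
proof -
  assume f: "C n f" and g: "C n g"
  have "C n (\<lambda>xs. rec_nat (f xs) (\<lambda>i v. v - 1) (g xs))"
    by (intro rec pred proj f g) auto
  moreover have "rec_nat a (\<lambda>i v. v - 1) m = a - m" for a m :: nat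
    by (induction m) auto
  ultimately show ?thesis by simp
qed

lemma eq0: "C n f \<Longrightarrow> C n (\<lambda>xs. of_bool (f xs = 0))"
proof -
  assume f: "C n f"
  have "C n (\<lambda>xs. 1 - f xs)"
    by (intro diff const f)
  then show ?thesis
    by (rule ext) auto
qed

lemma not: "C n (\<lambda>xs. of_bool (P xs)) \<Longrightarrow> C n (\<lambda>xs. of_bool (\<not> P xs))"
  by (rule ext[OF eq0]) auto

lemma conj: "\<lbrakk>C n (\<lambda>xs. of_bool (P xs)); C n (\<lambda>xs. of_bool (Q xs))\<rbrakk> \<Longrightarrow>
    C n (\<lambda>xs. of_bool (P xs \<and> Q xs))"
  using mult[of n "\<lambda>xs. of_bool (P xs)" "\<lambda>xs. of_bool (Q xs)"] by (simp add: of_bool_conj)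

lemma disj: "\<lbrakk>C n (\<lambda>xs. of_bool (P xs)); C n (\<lambda>xs. of_bool (Q xs))\<rbrakk> \<Longrightarrow>
    C n (\<lambda>xs. of_bool (P xs \<or> Q xs))"
proof -
  assume "C n (\<lambda>xs. of_bool (P xs))" "C n (\<lambda>xs. of_bool (Q xs))"
  then have "C n (\<lambda>xs. of_bool (\<not> (\<not> P xs \<and> \<not> Q xs)))"
    by (intro not conj)
  then show ?thesis by simp
qed

lemma le: "\<lbrakk>C n f; C n g\<rbrakk> \<Longrightarrow> C n (\<lambda>xs. of_bool (f xs \<le> g xs))"
  by (rule ext[OF eq0[OF diff]]) auto

lemma eq: "\<lbrakk>C n f; C n g\<rbrakk> \<Longrightarrow> C n (\<lambda>xs. of_bool (f xs = g xs))"
  by (rule ext[OF conj[OF le le, of n f g g f]]) auto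

lemma "if": "\<lbrakk>C n (\<lambda>xs. of_bool (P xs)); C n f; C n g\<rbrakk> \<Longrightarrow>
    C n (\<lambda>xs. if P xs then f xs else g xs)"
  by (rule ext[of n "\<lambda>xs. of_bool (P xs) * f xs + of_bool (\<not> P xs) * g xs"])
    (auto intro!: add mult not)

lemma mem_finite: "\<lbrakk>finite B; C n f\<rbrakk> \<Longrightarrow> C n (\<lambda>xs. of_bool (f xs \<in> B))"
proof (induction B rule: finite_induct)
  case empty
  then show ?case by (simp add: zero)
next
  case (insert b B)
  then have "C n (\<lambda>xs. of_bool (f xs = b \<or> f xs \<in> B))"
    by (intro disj eq const) auto
  then show ?case by simp
qed

text \<open>The bounded quantifier is a product of truth values accumulated by recursion.\<close>

lemma all_less:
  assumes P: "C (Suc n) (\<lambda>xs. of_bool (P (xs ! 0) (tl xs)))" and k: "C n k"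
  shows "C n (\<lambda>xs. of_bool (\<forall>i<k xs. P i xs))"
proof -
  \<comment> \<open>\<open>P\<close> has to skip the accumulator, which sits between the counter and
    the parameters.\<close>
  have P': "C (Suc (Suc n)) (\<lambda>xs. of_bool (P (xs ! 0) (tl (tl xs))))"
    using comp_drop[of "[\<lambda>xs. xs ! 0]" n "\<lambda>xs. of_bool (P (xs ! 0) (tl xs))" 2] P
    by (simp add: proj drop_Suc numeral_2_eq_2)
  have "C n (\<lambda>xs. rec_nat (1 :: nat) (\<lambda>i v. v * of_bool (P i xs)) (k xs))"
    by (intro rec const mult proj k P') auto
  moreover have "rec_nat (1 :: nat) (\<lambda>i v. v * of_bool (P i xs)) m = of_bool (\<forall>i<m. P i xs)" for m xs
    by (induction m) (auto simp: less_Suc_eq)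
  ultimately show ?thesis by simp
qed

lemma mod2: "C n f \<Longrightarrow> C n (\<lambda>xs. f xs mod 2)"
proof -
  assume f: "C n f"
  have "C n (\<lambda>xs. rec_nat 0 (\<lambda>i v. 1 - v) (f xs))"
    by (intro rec const diff proj f) auto
  moreover have "rec_nat 0 (\<lambda>i v. 1 - v) m = m mod 2" for m :: nat
    by (induction m) (auto simp: mod_Suc)
  ultimately show ?thesis by simp
qed

lemma div2: "C n f \<Longrightarrow> C n (\<lambda>xs. f xs div 2)"
proof -
  assume f: "C n f"
  \<comment> \<open>\<open>m div 2\<close> counts the odd numbers below \<open>m\<close>.\<close>
  have "C n (\<lambda>xs. rec_nat 0 (\<lambda>i v. v + i mod 2) (f xs))"
    by (intro rec const add mod2 proj f) auto
  moreover have "rec_nat 0 (\<lambda>i v. v + i mod 2) m = m div 2" for m :: nat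
    by (induction m) (auto, presburger)
  ultimately show ?thesis by simp
qed

lemma prod_list: "(\<And>g. g \<in> set gs \<Longrightarrow> C n g) \<Longrightarrow> C n (\<lambda>xs. prod_list (map (\<lambda>g. g xs) gs))"
  by (induction gs) (auto intro: const mult)

end

section \<open>The two instances: primitive recursive and total recursive functions\<close>

definition prim_rec_fun :: "nat \<Rightarrow> (nat list \<Rightarrow> nat) \<Rightarrow> bool" where
  "prim_rec_fun n f \<longleftrightarrow> (\<exists>p. prim_rec n p \<and> (\<forall>xs. length xs = n \<longrightarrow> p xs = f xs))"

definition rec_fun :: "nat \<Rightarrow> (nat list \<Rightarrow> nat) \<Rightarrow> bool" where
  "rec_fun n f \<longleftrightarrow> (\<exists>p. partial_rec n p \<and> (\<forall>xs. length xs = n \<longrightarrow> p xs = Some (f xs)))"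

lemma those_eq: "those xs = (if None \<in> set xs then None else Some (map the xs))"
  by (induction xs) (auto split: option.splits)

interpretation PR: rec_closed prim_rec_fun
proof
  fix n f g
  assume "prim_rec_fun n f" "\<And>xs. length xs = n \<Longrightarrow> f xs = g xs"
  then show "prim_rec_fun n g"
    unfolding prim_rec_fun_def by metis
next
  fix n show "prim_rec_fun n (\<lambda>xs. 0)"
    unfolding prim_rec_fun_def using prim_rec.zero by blast
next
  show "prim_rec_fun (Suc 0) (\<lambda>xs. Suc (xs ! 0))"
    unfolding prim_rec_fun_def using prim_rec.succ by auto
next
  fix i n :: nat assume "i < n" then show "prim_rec_fun n (\<lambda>xs. xs ! i)"
    unfolding prim_rec_fun_def using prim_rec.proj by blast
next
  fix gs f n
  assume "prim_rec_fun (length gs) f" and gs: "\<And>g. g \<in> set gs \<Longrightarrow> prim_rec_fun n g"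
  then obtain p where p: "prim_rec (length gs) p" "\<And>xs. length xs = length gs \<Longrightarrow> p xs = f xs"
    unfolding prim_rec_fun_def by blast
  obtain q where q: "\<And>g. g \<in> set gs \<Longrightarrow> prim_rec n (q g)"
    "\<And>g xs. \<lbrakk>g \<in> set gs; length xs = n\<rbrakk> \<Longrightarrow> q g xs = g xs"
    using gs unfolding prim_rec_fun_def by metis
  have "prim_rec n (\<lambda>xs. p (map (\<lambda>g. g xs) (map q gs)))"
    using p q by (intro prim_rec.comp) auto
  moreover have "p (map (\<lambda>g. g xs) (map q gs)) = f (map (\<lambda>g. g xs) gs)" if "length xs = n" for xs
  proof -
    have "map (\<lambda>g. g xs) (map q gs) = map (\<lambda>g. g xs) gs"
      using q that by auto
    then show ?thesis by (simp add: p del: map_map)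
  qed
  ultimately show "prim_rec_fun n (\<lambda>xs. f (map (\<lambda>g. g xs) gs))"
    unfolding prim_rec_fun_def by blast
next
  fix n f g
  assume "prim_rec_fun n f" "prim_rec_fun (Suc (Suc n)) g"
  then obtain p q where p: "prim_rec n p" "\<And>xs. length xs = n \<Longrightarrow> p xs = f xs"
    and q: "prim_rec (Suc (Suc n)) q" "\<And>xs. length xs = Suc (Suc n) \<Longrightarrow> q xs = g xs"
    unfolding prim_rec_fun_def by blast
  show "prim_rec_fun (Suc n) (\<lambda>xs. rec_nat (f (tl xs)) (\<lambda>k v. g (k # v # tl xs)) (hd xs))"
    unfolding prim_rec_fun_def
    by (intro exI conjI, rule prim_rec.prec[OF p(1) q(1)]) (simp add: p q)
qed

interpretation TR: rec_closed rec_fun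
proof
  fix n f g
  assume "rec_fun n f" "\<And>xs. length xs = n \<Longrightarrow> f xs = g xs"
  then show "rec_fun n g"
    unfolding rec_fun_def by metis
next
  fix n show "rec_fun n (\<lambda>xs. 0)"
    unfolding rec_fun_def using partial_rec.zero by blast
next
  show "rec_fun (Suc 0) (\<lambda>xs. Suc (xs ! 0))"
    unfolding rec_fun_def using partial_rec.succ by auto
next
  fix i n :: nat assume "i < n" then show "rec_fun n (\<lambda>xs. xs ! i)"
    unfolding rec_fun_def using partial_rec.proj by blast
next
  fix gs f n
  assume "rec_fun (length gs) f" and gs: "\<And>g. g \<in> set gs \<Longrightarrow> rec_fun n g"
  then obtain p where p: "partial_rec (length gs) p" "\<And>xs. length xs = length gs \<Longrightarrow> p xs = Some (f xs)"
    unfolding rec_fun_def by blast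
  obtain q where q: "\<And>g. g \<in> set gs \<Longrightarrow> partial_rec n (q g)"
    "\<And>g xs. \<lbrakk>g \<in> set gs; length xs = n\<rbrakk> \<Longrightarrow> q g xs = Some (g xs)"
    using gs unfolding rec_fun_def by metis
  have "partial_rec n (\<lambda>xs. Option.bind (those (map (\<lambda>g. g xs) (map q gs))) p)"
    using p q by (intro partial_rec.comp) auto
  moreover have "Option.bind (those (map (\<lambda>g. g xs) (map q gs))) p = Some (f (map (\<lambda>g. g xs) gs))"
    if "length xs = n" for xs
  proof -
    have "map (\<lambda>g. g xs) (map q gs) = map (\<lambda>g. Some (g xs)) gs"
      using q that by auto
    moreover have "those (map (\<lambda>g. Some (g xs)) gs) = Some (map (\<lambda>g. g xs) gs)"
      by (auto simp: those_eq comp_def)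
    ultimately show ?thesis by (simp add: p del: map_map)
  qed
  ultimately show "rec_fun n (\<lambda>xs. f (map (\<lambda>g. g xs) gs))"
    unfolding rec_fun_def by blast
next
  fix n f g
  assume "rec_fun n f" "rec_fun (Suc (Suc n)) g"
  then obtain p q where p: "partial_rec n p" "\<And>xs. length xs = n \<Longrightarrow> p xs = Some (f xs)"
    and q: "partial_rec (Suc (Suc n)) q" "\<And>xs. length xs = Suc (Suc n) \<Longrightarrow> q xs = Some (g xs)"
    unfolding rec_fun_def by blast
  have *: "rec_nat (p ys) (\<lambda>k w. Option.bind w (\<lambda>v. q (k # v # ys))) m
      = Some (rec_nat (f ys) (\<lambda>k v. g (k # v # ys)) m)" if "length ys = n" for ys m
    using that by (induction m) (auto simp: p q)
  show "rec_fun (Suc n) (\<lambda>xs. rec_nat (f (tl xs)) (\<lambda>k v. g (k # v # tl xs)) (hd xs))"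
    unfolding rec_fun_def
    by (intro exI conjI, rule partial_rec.prec[OF p(1) q(1)]) (simp add: *)
qed

text \<open>\<open>mu\<close> looks for a zero, hence the negation of \<open>P\<close> in the test.
  The test is total and a witness exists, so the minimization is defined everywhere.\<close>

lemma rec_fun_Least:
  assumes f: "rec_fun (Suc n) (\<lambda>xs. of_bool (\<not> P (xs ! 0) (tl xs)))"
    and ex: "\<And>xs. length xs = n \<Longrightarrow> \<exists>k. P k xs"
  shows "rec_fun n (\<lambda>xs. LEAST k. P k xs)"
proof -
  obtain p where p: "partial_rec (Suc n) p"
    "\<And>xs. length xs = Suc n \<Longrightarrow> p xs = Some (of_bool (\<not> P (xs ! 0) (tl xs)))"
    using f unfolding rec_fun_def by blast
  have "mu p xs = Some (LEAST k. P k xs)" if "length xs = n" for xs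
    using ex[OF that] that by (auto simp: mu_def p)
  then show ?thesis
    unfolding rec_fun_def using partial_rec.mu[OF p(1)] by blast
qed

section \<open>Primitive recursive approximations of partial recursive functions\<close>

text \<open>
  A partial recursive function is the limit of primitive recursive approximations, in which
  \<open>0\<close> stands for \<open>not yet computed\<close> and \<open>Suc v\<close> for the final value \<open>v\<close>.
\<close>

definition code_option :: "nat option \<Rightarrow> nat" where
  "code_option = case_option 0 Suc"

lemma code_option_simps [simp]: "code_option None = 0" "code_option (Some v) = Suc v"
  by (simp_all add: code_option_def)

text \<open>Monotonicity in the stage is not demanded: \<open>F\<close> may return to 0 before it
  settles. For \<open>w = None\<close> the clauses force \<open>F\<close> to be constantly
  0.\<close>

definition approximates :: "(nat \<Rightarrow> nat) \<Rightarrow> nat option \<Rightarrow> bool" where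
  "approximates F w \<longleftrightarrow> (\<forall>t. F t \<noteq> 0 \<longrightarrow> F t = code_option w) \<and> (\<exists>t0. \<forall>t\<ge>t0. F t = code_option w)"

text \<open>For undefined \<open>w\<close> the first premise already makes \<open>F\<close>
  constantly 0, so convergence has to be checked for defined values only.\<close>

lemma approximatesI:
  assumes "\<And>t. F t \<noteq> 0 \<Longrightarrow> F t = code_option w"
    and "\<And>v. w = Some v \<Longrightarrow> \<exists>t0. \<forall>t\<ge>t0. F t = Suc v"
  shows "approximates F w"
proof (cases w)
  case None
  then have "F t = code_option w" for t
    using assms(1)[of t] by auto
  then show ?thesis by (simp add: approximates_def)
next
  case (Some v)
  then show ?thesis using assms by (auto simp: approximates_def)
qed

lemma approximates_const: "approximates (\<lambda>t. Suc v) (Some v)"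
  by (simp add: approximates_def)

lemma approximatesD: "approximates F w \<Longrightarrow> F t \<noteq> 0 \<Longrightarrow> F t = code_option w"
  by (simp add: approximates_def)

lemma approximates_ev: "approximates F w \<Longrightarrow> \<exists>t0. \<forall>t\<ge>t0. F t = code_option w"
  by (simp add: approximates_def)

lemma approximates_ev_finite:
  assumes "finite I" "\<And>i. i \<in> I \<Longrightarrow> approximates (F i) (w i)"
  shows "\<exists>t0. \<forall>t\<ge>t0. \<forall>i\<in>I. F i t = code_option (w i)"
  using assms
proof (induction rule: finite_induct)
  case (insert i I)
  then obtain t0 t1 where "\<forall>t\<ge>t0. \<forall>i\<in>I. F i t = code_option (w i)"
    and "\<forall>t\<ge>t1. F i t = code_option (w i)"
    using approximates_ev by (metis insertCI)
  then show ?case by (intro exI[of _ "max t0 t1"]) auto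
qed simp

text \<open>Strict composition: the outer approximation is consulted only when all arguments are
  computed. Subtracting 1 decodes them, and as nonzero values are final, the decoded arguments are
  correct at whatever stage they appear.\<close>

lemma approximates_bind_list:
  assumes F: "\<And>xs. length xs = length ws \<Longrightarrow> approximates (\<lambda>t. F t xs) (f xs)"
    and G: "length Gs = length ws" "\<And>i. i < length ws \<Longrightarrow> approximates (Gs ! i) (ws ! i)"
  shows "approximates (\<lambda>t. if \<forall>g\<in>set Gs. g t \<noteq> 0 then F t (map (\<lambda>g. g t - 1) Gs) else 0)
    (Option.bind (those ws) f)" (is "approximates ?H _")
proof (rule approximatesI)
  fix t
  assume nz: "?H t \<noteq> 0"
  then have *: "\<forall>g\<in>set Gs. g t \<noteq> 0" by presburger
  have ws: "ws ! i = Some ((Gs ! i) t - 1)" if "i < length ws" for i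
  proof -
    have "(Gs ! i) t \<noteq> 0" using * G(1) that by auto
    then show ?thesis
      using approximatesD[OF G(2)[OF that], of t] by (cases "ws ! i") auto
  qed
  then have "None \<notin> set ws"
    by (auto simp: in_set_conv_nth)
  moreover have "map the ws = map (\<lambda>g. g t - 1) Gs"
    using ws G(1) by (intro nth_equalityI) auto
  ultimately have "those ws = Some (map (\<lambda>g. g t - 1) Gs)"
    by (simp add: those_eq)
  then show "?H t = code_option (Option.bind (those ws) f)"
    using approximatesD[OF F, of "map (\<lambda>g. g t - 1) Gs" t] G(1) nz * by auto
next
  fix v
  assume v: "Option.bind (those ws) f = Some v"
  then have ws: "None \<notin> set ws" and fv: "f (map the ws) = Some v"
    by (auto simp: those_eq split: if_splits)
  obtain t0 where t0: "\<forall>t\<ge>t0. \<forall>i<length ws. (Gs ! i) t = code_option (ws ! i)"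
    using approximates_ev_finite[of "{..<length ws}" "\<lambda>i. Gs ! i" "\<lambda>i. ws ! i"] G(2) by auto
  obtain t1 where t1: "\<forall>t\<ge>t1. F t (map the ws) = Suc v"
    using approximates_ev[OF F, of "map the ws"] fv by auto
  have "?H t = Suc v" if "t \<ge> max t0 t1" for t
  proof -
    have *: "(Gs ! i) t = Suc (the (ws ! i))" if "i < length ws" for i
      using t0 \<open>t \<ge> max t0 t1\<close> that ws by (cases "ws ! i") (auto simp: in_set_conv_nth)
    then have "map (\<lambda>g. g t - 1) Gs = map the ws"
      using G(1) by (intro nth_equalityI) auto
    moreover have "\<forall>g\<in>set Gs. g t \<noteq> 0"
      using * G(1) by (auto simp: in_set_conv_nth)
    ultimately show ?thesis using t1 that by auto
  qed
  then show "\<exists>t0. \<forall>t\<ge>t0. ?H t = Suc v" by blast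
qed

text \<open>Serves one step of a primitive recursion, where only the previous value may be
  undefined.\<close>

lemma approximates_bind:
  assumes F: "\<And>v. approximates (\<lambda>t. F t v) (f v)" and G: "approximates G w"
  shows "approximates (\<lambda>t. if G t = 0 then 0 else F t (G t - 1)) (Option.bind w f)"
    (is "approximates ?H _")
proof (rule approximatesI)
  fix t
  assume nz: "?H t \<noteq> 0"
  then have "w = Some (G t - 1)"
    using approximatesD[OF G, of t] by (cases w) (auto split: if_splits)
  then show "?H t = code_option (Option.bind w f)"
    using approximatesD[OF F, of t] nz by (auto split: if_splits)
next
  fix v
  assume "Option.bind w f = Some v"
  then obtain u where u: "w = Some u" "f u = Some v"
    by (auto simp: bind_eq_Some_conv)
  obtain t0 where "\<forall>t\<ge>t0. G t = Suc u"
    using approximates_ev[OF G] u by auto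
  moreover obtain t1 where "\<forall>t\<ge>t1. F t u = Suc v"
    using approximates_ev[OF F[of u]] u by auto
  ultimately show "\<exists>t0. \<forall>t\<ge>t0. ?H t = Suc v"
    by (intro exI[of _ "max t0 t1"]) auto
qed

text \<open>
  Bounded minimization on approximations: the search stops at the first \<open>k < t\<close> where the value is
  not yet computed (\<open>f k = 0\<close>) or computed to be zero (\<open>f k = 1\<close>).
\<close>

definition search :: "(nat \<Rightarrow> nat) \<Rightarrow> nat \<Rightarrow> nat" where
  "search f t = rec_nat 0 (\<lambda>k v. if v = k \<and> 2 \<le> f k then Suc v else v) t"

text \<open>The accumulator equals the loop counter exactly as long as the search has not stopped,
  so a result below \<open>t\<close> marks a stop.\<close>

lemma search: "search f t \<le> t" "j < search f t \<Longrightarrow> 2 \<le> f j" "search f t < t \<Longrightarrow> f (search f t) < 2"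
proof (induction t)
  case (Suc t)
  have [simp]: "search f (Suc t) = (if search f t = t \<and> 2 \<le> f t then Suc (search f t) else search f t)"
    by (simp add: search_def)
  { case 1 show ?case using Suc.IH(1) by simp
  next
    case 2 then show ?case using Suc.IH by (auto split: if_splits simp: less_Suc_eq)
  next
    case 3 then show ?case using Suc.IH by (auto split: if_splits simp: less_Suc_eq not_le)
  }
qed (auto simp: search_def)

lemma search_eq:
  assumes "k < t" "\<And>j. j < k \<Longrightarrow> 2 \<le> f j" "f k < 2"
  shows "search f t = k"
  using search[where f = f and t = t] assms by (metis linorder_neqE_nat not_le)

text \<open>All positions below the search result are known to be defined and nonzero. A computed
  zero at the result is therefore the least one, with no undefined value before it.\<close>

lemma approximates_mu:
  assumes F: "\<And>k. approximates (\<lambda>t. F t k) (f (k # xs))"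
  shows "approximates (\<lambda>t. if F t (search (F t) t) = 1 then Suc (search (F t) t) else 0) (mu f xs)"
    (is "approximates ?H _")
proof (rule approximatesI)
  fix t
  define L where "L = search (F t) t"
  assume "?H t \<noteq> 0"
  then have L: "F t L = 1" "?H t = Suc L"
    unfolding L_def by presburger+
  then have fL: "f (L # xs) = Some 0"
    using approximatesD[OF F, of t L] by (cases "f (L # xs)") auto
  have fj: "f (j # xs) \<noteq> None" "f (j # xs) \<noteq> Some 0" if "j < L" for j
  proof -
    have "2 \<le> F t j" using search(2) that L_def by blast
    then have "2 \<le> code_option (f (j # xs))"
      using approximatesD[OF F, of t j] by auto
    then show "f (j # xs) \<noteq> None" "f (j # xs) \<noteq> Some 0"
      by (cases "f (j # xs)"; auto)+
  qed
  have "(LEAST k. f (k # xs) = Some 0) = L"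
    using fL fj by (intro Least_equality) (auto simp: not_less[symmetric])
  then have "mu f xs = Some L"
    unfolding mu_def using fL fj by auto
  then show "?H t = code_option (mu f xs)" using L by simp
next
  fix k
  assume k: "mu f xs = Some k"
  then obtain l where l: "f (l # xs) = Some 0" "\<forall>j<l. f (j # xs) \<noteq> None"
    and kl: "k = (LEAST k. f (k # xs) = Some 0)"
    by (auto simp: mu_def split: if_splits)
  have fk: "f (k # xs) = Some 0" "k \<le> l"
    unfolding kl using l(1) by (auto intro: LeastI Least_le)
  have fj: "2 \<le> code_option (f (j # xs))" if "j < k" for j
  proof -
    have "f (j # xs) \<noteq> None" using l that fk by auto
    moreover have "f (j # xs) \<noteq> Some 0" using not_less_Least that kl by blast
    ultimately show ?thesis by (cases "f (j # xs)") auto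
  qed
  obtain t0 where t0: "\<forall>t\<ge>t0. \<forall>j\<le>k. F t j = code_option (f (j # xs))"
    using approximates_ev_finite[of "{..k}" "\<lambda>j t. F t j" "\<lambda>j. f (j # xs)"] F by auto
  \<comment> \<open>The search only inspects positions below \<open>t\<close>, so
    \<open>Suc k\<close> is needed for it to stop at \<open>k\<close>.\<close>
  have "?H t = Suc k" if "t \<ge> max t0 (Suc k)" for t
  proof -
    have "search (F t) t = k"
      using t0 fj fk that by (intro search_eq) auto
    then show ?thesis using t0 fk that by auto
  qed
  then show "\<exists>t0. \<forall>t\<ge>t0. ?H t = Suc k" by blast
qed

text \<open>Induction on the derivation, with the same stage \<open>t\<close> handed to all
  subfunctions. The unbounded search of \<open>mu\<close> becomes a search below \<open>t\<close>,
  so only bounded loops remain.\<close>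

lemma partial_rec_approximation:
  assumes "partial_rec n p"
  shows "\<exists>F. prim_rec_fun (Suc n) (\<lambda>xs. F (xs ! 0) (tl xs)) \<and>
    (\<forall>xs. length xs = n \<longrightarrow> approximates (\<lambda>t. F t xs) (p xs))"
  using assms
proof induction
  case (zero n)
  show ?case
    by (rule exI[of _ "\<lambda>t xs. Suc 0"]) (auto intro: PR.const approximates_const)
next
  case succ
  show ?case
    by (rule exI[of _ "\<lambda>t xs. Suc (Suc (xs ! 0))"]) (auto intro!: PR.Suc PR.proj_tl approximates_const)
next
  case (proj i n)
  then show ?case
    by (intro exI[of _ "\<lambda>t xs. Suc (xs ! i)"]) (auto intro!: PR.Suc PR.proj_tl approximates_const)
next
  case (comp gs f n)
  then obtain F where F: "prim_rec_fun (Suc (length gs)) (\<lambda>xs. F (xs ! 0) (tl xs))"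
    "\<And>xs. length xs = length gs \<Longrightarrow> approximates (\<lambda>t. F t xs) (f xs)"
    by blast
  from comp.IH(2) obtain G where G: "\<And>g. g \<in> set gs \<Longrightarrow> prim_rec_fun (Suc n) (\<lambda>xs. G g (xs ! 0) (tl xs))"
    "\<And>g xs. \<lbrakk>g \<in> set gs; length xs = n\<rbrakk> \<Longrightarrow> approximates (\<lambda>t. G g t xs) (g xs)"
    by metis
  let ?H = "\<lambda>t xs. if \<forall>g\<in>set (map (\<lambda>g t. G g t xs) gs). g t \<noteq> 0
      then F t (map (\<lambda>g. g t - 1) (map (\<lambda>g t. G g t xs) gs)) else 0"
  \<comment> \<open>\<open>?p\<close> holds the truth values of the tests, \<open>?q\<close> the
    stage and the decoded arguments. Multiplying by the product of \<open>?p\<close> replaces the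
    conditional in \<open>?H\<close>.\<close>
  let ?p = "map (\<lambda>g ts. of_bool (G g (ts ! 0) (tl ts) \<noteq> 0)) gs"
  let ?q = "(\<lambda>ts. ts ! 0) # map (\<lambda>g ts. G g (ts ! 0) (tl ts) - 1) gs"
  have p: "(prod_list (map (\<lambda>g. g ts) ?p) :: nat) = of_bool (\<forall>g\<in>set gs. G g (ts ! 0) (tl ts) \<noteq> 0)" for ts
    by (induction gs) auto
  have G': "prim_rec_fun (Suc n) (\<lambda>ts. G g (ts ! 0) (tl ts) - 1)"
    "prim_rec_fun (Suc n) (\<lambda>ts. of_bool (G g (ts ! 0) (tl ts) \<noteq> 0))" if "g \<in> set gs" for g
    by (intro PR.not PR.eq PR.const PR.pred G that)+
  have "prim_rec_fun (Suc n) (\<lambda>ts. F (map (\<lambda>g. g ts) ?q ! 0) (tl (map (\<lambda>g. g ts) ?q)) *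
      prod_list (map (\<lambda>g. g ts) ?p))"
    using F(1) by (intro PR.mult PR.prod_list PR.comp[where f = "\<lambda>xs. F (xs ! 0) (tl xs)"])
      (use G' in \<open>auto intro: PR.proj\<close>)
  then have "prim_rec_fun (Suc n) (\<lambda>ts. ?H (ts ! 0) (tl ts))"
    unfolding p by (rule PR.ext) (auto simp: comp_def)
  moreover have "approximates (\<lambda>t. ?H t xs) (Option.bind (those (map (\<lambda>g. g xs) gs)) f)"
    if "length xs = n" for xs
    by (rule approximates_bind_list) (auto intro: F G that)
  ultimately show ?case by (intro exI[of _ ?H]) blast
next
  case (prec n f g)
  then obtain F G where F: "prim_rec_fun (Suc n) (\<lambda>xs. F (xs ! 0) (tl xs))"
    "\<And>xs. length xs = n \<Longrightarrow> approximates (\<lambda>t. F t xs) (f xs)"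
    and G: "prim_rec_fun (Suc (Suc (Suc n))) (\<lambda>xs. G (xs ! 0) (tl xs))"
    "\<And>xs. length xs = Suc (Suc n) \<Longrightarrow> approximates (\<lambda>t. G t xs) (g xs)"
    by blast
  \<comment> \<open>The accumulator is a code, so 0 for a value not yet computed is passed on by all
    later steps.\<close>
  define H where "H t ys k = rec_nat (F t ys) (\<lambda>k v. if v = 0 then 0 else G t (k # (v - 1) # ys)) k"
    for t ys k
  have "prim_rec_fun (Suc (Suc n)) (\<lambda>ts. H (ts ! 0) (tl (tl ts)) (ts ! 1))"
    unfolding H_def
  proof (intro PR.rec PR.if PR.eq PR.proj PR.const)
    show "prim_rec_fun (Suc (Suc n)) (\<lambda>xs. F (xs ! 0) (tl (tl xs)))"
      using PR.comp_drop[of "[\<lambda>xs. xs ! 0]" n "\<lambda>xs. F (xs ! 0) (tl xs)" 2] F(1)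
      by (simp add: PR.proj drop_Suc numeral_2_eq_2)
    \<comment> \<open>The arguments are counter, accumulator, stage and recursion bound, followed by
      the parameters.\<close>
    show "prim_rec_fun (Suc (Suc (Suc (Suc n)))) (\<lambda>xs. G (tl (tl xs) ! 0)
        (xs ! 0 # (xs ! 1 - 1) # tl (tl (tl (tl xs)))))"
      using PR.comp_drop[of "[\<lambda>xs. tl (tl xs) ! 0, \<lambda>xs. xs ! 0, \<lambda>xs. xs ! 1 - 1]" n
          "\<lambda>xs. G (xs ! 0) (tl xs)" 4] G(1)
      by (simp add: PR.proj PR.proj_tl_tl PR.pred[unfolded One_nat_def] drop_Suc eval_nat_numeral)
  qed auto
  then have "prim_rec_fun (Suc (Suc n)) (\<lambda>ts. H (ts ! 0) (tl (tl ts)) (hd (tl ts)))"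
    by (rule PR.ext) (auto simp: hd_conv_nth length_Suc_conv)
  moreover have "approximates (\<lambda>t. H t ys k)
      (rec_nat (f ys) (\<lambda>k w. Option.bind w (\<lambda>v. g (k # v # ys))) k)" if "length ys = n" for ys k
  proof (induction k)
    case 0
    show ?case using F that by (simp add: H_def)
  next
    case (Suc k)
    have "approximates (\<lambda>t. if H t ys k = 0 then 0 else G t (k # (H t ys k - 1) # ys))
        (Option.bind (rec_nat (f ys) (\<lambda>k w. Option.bind w (\<lambda>v. g (k # v # ys))) k) (\<lambda>v. g (k # v # ys)))"
      using approximates_bind[where F = "\<lambda>t v. G t (k # v # ys)", OF G(2) Suc] that by simp
    moreover have "H t ys (Suc k) = (if H t ys k = 0 then 0 else G t (k # (H t ys k - 1) # ys))" for t
      by (simp add: H_def)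
    ultimately show ?case by simp
  qed
  ultimately show ?case
    by (intro exI[of _ "\<lambda>t xs. H t (tl xs) (hd xs)"]) auto
next
  case (mu n f)
  then obtain F where F: "prim_rec_fun (Suc (Suc n)) (\<lambda>xs. F (xs ! 0) (tl xs))"
    "\<And>xs. length xs = Suc n \<Longrightarrow> approximates (\<lambda>t. F t xs) (f xs)"
    by blast
  let ?L = "\<lambda>t xs. search (\<lambda>k. F t (k # xs)) t"
  have F': "prim_rec_fun (Suc (Suc (Suc n))) (\<lambda>xs. F (tl (tl xs) ! 0) (xs ! 0 # tl (tl (tl xs))))"
    using PR.comp_drop[of "[\<lambda>xs. tl (tl xs) ! 0, \<lambda>xs. xs ! 0]" n "\<lambda>xs. F (xs ! 0) (tl xs)" 3] F(1)
    by (simp add: PR.proj PR.proj_tl_tl drop_Suc eval_nat_numeral)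
  have L: "prim_rec_fun (Suc n) (\<lambda>ts. ?L (ts ! 0) (tl ts))"
    unfolding search_def
    by (intro PR.rec PR.if PR.conj PR.eq PR.le PR.Suc PR.proj PR.const F') auto
  have "prim_rec_fun (Suc n) (\<lambda>ts. F (ts ! 0) (?L (ts ! 0) (tl ts) # tl ts))"
    using PR.comp_drop[of "[\<lambda>xs. xs ! 0, \<lambda>ts. ?L (ts ! 0) (tl ts)]" n "\<lambda>xs. F (xs ! 0) (tl xs)" 1] F(1) L
    by (simp add: PR.proj drop_Suc)
  then have "prim_rec_fun (Suc n) (\<lambda>ts. if F (ts ! 0) (?L (ts ! 0) (tl ts) # tl ts) = 1
      then Suc (?L (ts ! 0) (tl ts)) else 0)"
    by (intro PR.if PR.eq PR.const PR.Suc L)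
  moreover have "approximates (\<lambda>t. if F t (?L t xs # xs) = 1 then Suc (?L t xs) else 0) (mu f xs)"
    if "length xs = n" for xs
    by (rule approximates_mu[where F = "\<lambda>t k. F t (k # xs)"], rule F(2)) (simp add: that)
  ultimately show ?case
    by (intro exI[of _ "\<lambda>t xs. if F t (?L t xs # xs) = 1 then Suc (?L t xs) else 0"]) blast
qed

lemma rec_fun_approximation:
  assumes "rec_fun n f"
  shows "\<exists>F. prim_rec_fun (Suc n) (\<lambda>xs. F (xs ! 0) (tl xs)) \<and>
    (\<forall>xs. length xs = n \<longrightarrow> approximates (\<lambda>t. F t xs) (Some (f xs)))"
  using assms partial_rec_approximation unfolding rec_fun_def by metis

section \<open>Numbering by stages\<close>

text \<open>The counter rests between two hits of \<open>Q\<close>, so the first hit after it has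
  reached \<open>i\<close> still finds the value \<open>i\<close>.\<close>

lemma counter_hits:
  fixes f :: "nat \<Rightarrow> nat"
  assumes 0: "f 0 = 0" and Suc: "\<And>t. f (Suc t) = (if Q t then Suc (f t) else f t)"
    and inf: "\<And>t. \<exists>t'\<ge>t. Q t'"
  shows "\<exists>t. Q t \<and> f t = i"
proof -
  have next_hit: "\<exists>t'\<ge>t. Q t' \<and> f t' = f t" for t
  proof -
    obtain u where u: "t \<le> u" "Q u" and least: "\<And>t'. \<lbrakk>t' < u; t \<le> t'\<rbrakk> \<Longrightarrow> \<not> Q t'"
      using inf[of t] exists_least_iff[of "\<lambda>t'. t \<le> t' \<and> Q t'"] by blast
    have "f t' = f t" if "t \<le> t'" "t' \<le> u" for t'
      using that
    proof (induction t' rule: dec_induct)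
      case (step t')
      have "\<not> Q t'" using least step by simp
      then show ?case using step Suc[of t'] by simp
    qed simp
    then show ?thesis using u by blast
  qed
  show ?thesis
  proof (induction i)
    case 0
    then show ?case using next_hit[of 0] \<open>f 0 = 0\<close> by auto
  next
    case (Suc i)
    then obtain t where "Q t" "f t = i" by blast
    then have "f (Suc t) = Suc i" using assms(2) by simp
    then show ?case using next_hit[of "Suc t"] by auto
  qed
qed

text \<open>Distinct hits see distinct counter values; this makes the numbering by stages
  injective.\<close>

lemma counter_less:
  fixes f :: "nat \<Rightarrow> nat"
  assumes Suc: "\<And>t. f (Suc t) = (if Q t then Suc (f t) else f t)" and "Q t" "t < t'"
  shows "f t < f t'"
proof -
  have "mono f" by (rule monoI, rule lift_Suc_mono_le[of f]) (auto simp: Suc)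
  then have "f (Suc t) \<le> f t'" using \<open>t < t'\<close> by (simp add: monoD)
  then show ?thesis using Suc \<open>Q t\<close> by simp
qed

text \<open>
  The even code \<open>2 * i\<close> stands for the \<open>i\<close>-th filler, and the odd code \<open>2 * d + 1\<close> for the node \<open>d\<close>,
  where \<open>d \<in> E\<close>. Infinitely many numbers outside \<open>E\<close> guarantee infinitely many filler stages.
\<close>

lemma prim_rec_numbering:
  fixes R :: "nat \<Rightarrow> nat \<Rightarrow> bool" and E B :: "nat set"
  assumes R: "rec_fun 2 (\<lambda>xs. of_bool (R (xs ! 0) (xs ! 1)))"
    and E: "rec_fun 1 (\<lambda>xs. of_bool (xs ! 0 \<in> E))"
    and inf: "infinite (- E)" and B: "finite B" "\<And>b. b \<in> B \<Longrightarrow> odd b"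
    and ee: "\<And>c c'. \<lbrakk>even c; even c'\<rbrakk> \<Longrightarrow> R c c' \<longleftrightarrow> c = c'"
    and oe: "\<And>c c'. \<lbrakk>odd c; c div 2 \<in> E; even c'; c < c'\<rbrakk> \<Longrightarrow> R c c' \<longleftrightarrow> c \<in> B"
    and eo: "\<And>c c'. \<lbrakk>even c; odd c'; c' div 2 \<in> E; c' < c\<rbrakk> \<Longrightarrow> \<not> R c c'"
  shows "\<exists>e. bij_betw e UNIV {c. even c \<or> c div 2 \<in> E} \<and> prim_rec_rel {(x, y). R (e x) (e y)}"
proof -
  obtain F' where F': "prim_rec_fun (Suc 2) (\<lambda>xs. F' (xs ! 0) (tl xs))"
    "\<And>xs. length xs = 2 \<Longrightarrow> approximates (\<lambda>t. F' t xs) (Some (of_bool (R (xs ! 0) (xs ! 1))))"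
    using rec_fun_approximation[OF R] by auto
  obtain G' where G': "prim_rec_fun (Suc 1) (\<lambda>xs. G' (xs ! 0) (tl xs))"
    "\<And>xs. length xs = 1 \<Longrightarrow> approximates (\<lambda>t. G' t xs) (Some (of_bool (xs ! 0 \<in> E)))"
    using rec_fun_approximation[OF E] by auto
  define F where "F t c c' = F' t [c, c']" for t c c'
  define G where "G t d = G' t [d]" for t d
  have F: "approximates (\<lambda>t. F t c c') (Some (of_bool (R c c')))" for c c'
    using F'(2)[of "[c, c']"] by (simp add: F_def)
  have G: "approximates (\<lambda>t. G t d) (Some (of_bool (d \<in> E)))" for d
    using G'(2)[of "[d]"] by (simp add: G_def)
  have "prim_rec_fun (Suc (Suc (Suc 0))) (\<lambda>xs. F (xs ! 0) (xs ! 1) (xs ! 2))"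
    using F'(1) unfolding F_def numeral_2_eq_2
    by (rule PR.ext) (auto simp: length_Suc_conv)
  note F_rec = PR.comp3[OF this]
  have "prim_rec_fun (Suc (Suc 0)) (\<lambda>xs. G (xs ! 0) (xs ! 1))"
    using G'(1) unfolding G_def One_nat_def
    by (rule PR.ext) (auto simp: length_Suc_conv)
  note G_rec = PR.comp2[OF this]

  \<comment> \<open>The codes below \<open>2 * d + 2\<close> are those of the nodes up to
    \<open>d\<close>, including \<open>d\<close> itself, and of the fillers up to index
    \<open>d\<close>.\<close>
  define ready where "ready t d \<longleftrightarrow> G t d \<noteq> 0 \<and>
    (\<forall>c<2 * d + 2. F t c (2 * d + 1) \<noteq> 0 \<and> F t (2 * d + 1) c \<noteq> 0)" for t d
  have "prim_rec_fun (Suc (Suc 0)) (\<lambda>xs. of_bool (ready (xs ! 0) (xs ! 1)))"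
    unfolding ready_def
    by (intro PR.conj PR.not PR.eq PR.all_less PR.add PR.mult F_rec G_rec PR.const PR.proj PR.proj_tl) auto
  note ready_rec = PR.comp2[OF this]
  \<comment> \<open>The next node to be decided; the pointer also moves past nodes that turn out to
    lie outside \<open>E\<close>.\<close>
  define ptr where "ptr t = rec_nat 0 (\<lambda>t v. if ready t v then Suc v else v) t" for t
  have ptr_0: "ptr 0 = 0" and ptr_Suc: "ptr (Suc t) = (if ready t (ptr t) then Suc (ptr t) else ptr t)" for t
    by (simp_all add: ptr_def)
  have "prim_rec_fun (Suc 0) (\<lambda>xs. ptr (xs ! 0))"
    unfolding ptr_def by (intro PR.rec PR.const PR.if ready_rec PR.Suc PR.proj) auto
  note ptr_rec = PR.comp1[OF this]
  \<comment> \<open>The value 2 codes the computed answer 1, that is, membership in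
    \<open>E\<close>.\<close>
  define direct where "direct t \<longleftrightarrow> ready t (ptr t) \<and> G t (ptr t) = 2" for t
  have "prim_rec_fun (Suc 0) (\<lambda>xs. of_bool (direct (xs ! 0)))"
    unfolding direct_def by (intro PR.conj PR.eq PR.const G_rec ready_rec ptr_rec PR.proj) auto
  note direct_rec = PR.comp1[OF this]
  \<comment> \<open>The number of fillers placed before stage \<open>t\<close>, hence the index of
    the next one.\<close>
  define junk where "junk t = rec_nat 0 (\<lambda>t v. if direct t then v else Suc v) t" for t
  have junk_0: "junk 0 = 0" and junk_Suc: "junk (Suc t) = (if \<not> direct t then Suc (junk t) else junk t)" for t
    by (simp_all add: junk_def)
  have "prim_rec_fun (Suc 0) (\<lambda>xs. junk (xs ! 0))"
    unfolding junk_def by (intro PR.rec PR.const PR.if direct_rec PR.Suc PR.proj) auto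
  note junk_rec = PR.comp1[OF this]
  define code where "code t = (if direct t then 2 * ptr t + 1 else 2 * junk t)" for t
  have "prim_rec_fun (Suc 0) (\<lambda>xs. code (xs ! 0))"
    unfolding code_def
    by (intro PR.const PR.if direct_rec PR.add PR.mult ptr_rec junk_rec PR.proj) auto
  note code_rec = PR.comp1[OF this]
  have direct_iff: "direct t \<longleftrightarrow> ready t (ptr t) \<and> ptr t \<in> E" for t
    using approximatesD[OF G, of t "ptr t"] by (auto simp: direct_def ready_def of_bool_def split: if_splits)
  have code_even: "even (code t) \<longleftrightarrow> \<not> direct t" for t
    by (simp add: code_def)
  have code_direct: "code t div 2 = ptr t" "code t = 2 * ptr t + 1" if "direct t" for t
    using that by (simp_all add: code_def)

  have ready_ev: "\<exists>t0. \<forall>t\<ge>t0. ready t d" for d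
  proof -
    obtain t0 where t0: "\<forall>t\<ge>t0. G t d = Suc (of_bool (d \<in> E))"
      using approximates_ev[OF G[of d]] by auto
    obtain t1 where t1: "\<forall>t\<ge>t1. \<forall>c\<in>{..<2*d+2}. F t c (2*d+1) = Suc (of_bool (R c (2*d+1)))"
      using approximates_ev_finite[of "{..<2*d+2}" "\<lambda>c t. F t c (2*d+1)" "\<lambda>c. Some (of_bool (R c (2*d+1)))"] F
      unfolding code_option_simps by blast
    obtain t2 where t2: "\<forall>t\<ge>t2. \<forall>c\<in>{..<2*d+2}. F t (2*d+1) c = Suc (of_bool (R (2*d+1) c))"
      using approximates_ev_finite[of "{..<2*d+2}" "\<lambda>c t. F t (2*d+1) c" "\<lambda>c. Some (of_bool (R (2*d+1) c))"] F
      unfolding code_option_simps by blast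
    show ?thesis
      using t0 t1 t2 by (intro exI[of _ "max t0 (max t1 t2)"]) (auto simp: ready_def)
  qed
  have inf_ready: "\<exists>t'\<ge>t. ready t' (ptr t')" for t
  proof (rule ccontr)
    \<comment> \<open>The pointer would be stuck at one node, which becomes ready
      eventually.\<close>
    assume *: "\<not> ?thesis"
    have "ptr t' = ptr t" if "t \<le> t'" for t'
      using that by (induction t' rule: dec_induct) (use * ptr_Suc in auto)
    moreover obtain t0 where "\<forall>t'\<ge>t0. ready t' (ptr t)"
      using ready_ev by blast
    ultimately show False
      using * by (metis max.cobounded1 max.cobounded2)
  qed
  note ptr_hits = counter_hits[of ptr "\<lambda>t. ready t (ptr t)", OF ptr_0 ptr_Suc inf_ready]
  note ptr_less = counter_less[of ptr "\<lambda>t. ready t (ptr t)", OF ptr_Suc]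
  have inf_junk: "\<exists>t'\<ge>t. \<not> direct t'" for t
  proof -
    \<comment> \<open>The pointer passes every number, and the stage at which it leaves a number
      outside \<open>E\<close> is a filler stage.\<close>
    obtain d where d: "d \<in> - E" "ptr t \<le> d"
      using inf finite_nat_set_iff_bounded_le[of "- E"] by (meson nle_le)
    obtain t' where t': "ready t' (ptr t')" "ptr t' = d"
      using ptr_hits by blast
    then have "t \<le> t'" using ptr_less[of t' t] d by (meson not_le)
    then show ?thesis using t' d direct_iff by auto
  qed
  note junk_hits = counter_hits[of junk "\<lambda>t. \<not> direct t", OF junk_0 junk_Suc inf_junk]
  note junk_less = counter_less[of junk "\<lambda>t. \<not> direct t", OF junk_Suc]

  have code_neq: "code x \<noteq> code y" if "x < y" for x y
  proof (cases "direct x \<longleftrightarrow> direct y")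
    case True
    show ?thesis
    proof (cases "direct x")
      case x: True
      then have "ptr x < ptr y"
        using ptr_less that direct_iff by blast
      then show ?thesis using True x by (simp add: code_def)
    next
      case x: False
      then have "junk x < junk y"
        using junk_less that by blast
      then show ?thesis using True x by (simp add: code_def)
    qed
  next
    case False
    then show ?thesis using code_even by metis
  qed
  have "bij_betw code UNIV {c. even c \<or> c div 2 \<in> E}"
  proof (rule bij_betwI')
    show "code x = code y \<longleftrightarrow> x = y" for x y
      using code_neq by (metis linorder_neqE_nat)
    show "code x \<in> {c. even c \<or> c div 2 \<in> E}" for x
      using code_even code_direct direct_iff by auto
    fix c assume c: "c \<in> {c. even c \<or> c div 2 \<in> E}"
    show "\<exists>x\<in>UNIV. c = code x"
    proof (cases "even c")
      case True
      obtain t where "\<not> direct t" "junk t = c div 2"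
        using junk_hits by blast
      then show ?thesis using True by (auto simp: code_def intro!: exI[of _ t])
    next
      case False
      obtain t where "ready t (ptr t)" "ptr t = c div 2"
        using ptr_hits by blast
      moreover from this have "direct t" using direct_iff c False by auto
      ultimately show ?thesis using False by (auto simp: code_def intro!: exI[of _ t])
    qed
  qed
  moreover have "prim_rec_rel {(x, y). R (code x) (code y)}"
  proof -
    \<comment> \<open>Approximations need not be monotone in the time, so both \<open>x\<close> and \<open>y\<close> are tried as the time
      bound: relations to a node placed at stage \<open>x\<close> are only known to be computed at time \<open>x\<close>.\<close>
    define S where "S x y \<longleftrightarrow> F x (code x) (code y) = 2 \<or> F y (code x) (code y) = 2 \<or>
      F x (code x) (code y) = 0 \<and> F y (code x) (code y) = 0 \<and> (code x = code y \<or> code x \<in> B)" for x y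
    have "prim_rec_fun (Suc (Suc 0)) (\<lambda>xs. of_bool (S (xs ! 0) (xs ! 1)))"
      unfolding S_def
      by (intro PR.disj PR.conj PR.eq PR.const PR.mem_finite B code_rec F_rec PR.proj) auto
    moreover have "R (code x) (code y) \<longleftrightarrow> S x y" for x y
    proof (cases "F x (code x) (code y) = 0 \<and> F y (code x) (code y) = 0")
      case False
      then show ?thesis
        using approximatesD[OF F, of x "code x" "code y"] approximatesD[OF F, of y "code x" "code y"]
        by (cases "R (code x) (code y)") (auto simp: S_def)
    next
      case True
      \<comment> \<open>Neither time bound gives an answer here, so the relation has to be one of
        the forced ones.\<close>
      have ready_less: "c < 2 * d + 2 \<Longrightarrow> F t c (2 * d + 1) \<noteq> 0 \<and> F t (2 * d + 1) c \<noteq> 0"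
        if "ready t d" for t c d
        using that unfolding ready_def by blast
      \<comment> \<open>A node is placed only when its relations to all codes up to its own are
        computed, so an uncomputed relation involves a larger code.\<close>
      have x: "code x < code y" if "direct x"
      proof (rule ccontr)
        assume "\<not> code x < code y"
        then have "code y < 2 * ptr x + 2" using code_direct[OF that] by simp
        then have "F x (2 * ptr x + 1) (code y) \<noteq> 0"
          using ready_less[of x "ptr x"] that direct_iff by blast
        then show False using True code_direct[OF that] by simp
      qed
      have y: "code y < code x" if "direct y"
      proof (rule ccontr)
        assume "\<not> code y < code x"
        then have "code x < 2 * ptr y + 2" using code_direct[OF that] by simp
        then have "F y (code x) (2 * ptr y + 1) \<noteq> 0"
          using ready_less[of y "ptr y"] that direct_iff by blast
        then show False using True code_direct[OF that] by simp
      qed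
      have S: "S x y \<longleftrightarrow> code x = code y \<or> code x \<in> B"
        using True by (simp add: S_def)
      \<comment> \<open>Two directly placed nodes would each have the smaller code.\<close>
      consider "direct x" "\<not> direct y" | "\<not> direct x" "direct y" | "\<not> direct x" "\<not> direct y"
        using x y by fastforce
      then show ?thesis
      proof cases
        case 1
        have "R (code x) (code y) \<longleftrightarrow> code x \<in> B"
          using 1 by (intro oe x) (simp_all add: code_even code_direct direct_iff)
        moreover have "code x \<noteq> code y" using 1 x by simp
        ultimately show ?thesis using S by blast
      next
        case 2
        have "\<not> R (code x) (code y)"
          using 2 by (intro eo y) (simp_all add: code_even code_direct direct_iff)
        moreover have "code x \<noteq> code y" "code x \<notin> B"
          using 2 y B(2) code_even by fastforce+
        ultimately show ?thesis using S by blast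
      next
        case 3
        then have "R (code x) (code y) \<longleftrightarrow> code x = code y"
          by (intro ee) (simp_all add: code_even)
        moreover have "code x \<notin> B" using 3 B(2) code_even by blast
        ultimately show ?thesis using S by blast
      qed
    qed
    ultimately have "prim_rec_fun 2 (\<lambda>xs. of_bool (R (code (xs ! 0)) (code (xs ! 1))))"
      by (simp add: numeral_2_eq_2)
    then obtain p where "prim_rec 2 p"
      "\<And>xs. length xs = 2 \<Longrightarrow> p xs = of_bool (R (code (xs ! 0)) (code (xs ! 1)))"
      unfolding prim_rec_fun_def by blast
    then show ?thesis
      unfolding prim_rec_rel_def by (intro exI[of _ p]) auto
  qed
  ultimately show ?thesis by blast
qed

section \<open>Trees\<close>

text \<open>Transport of structure: \<open>f\<close> maps the predecessors of \<open>a\<close>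
  injectively into those of \<open>f a\<close>, which gives finiteness, and comparability is pulled
  back along \<open>f\<close>.\<close>

lemma tree_inv_image:
  assumes T: "tree D r" and f: "bij_betw f A D"
  shows "tree A {(x, y) \<in> A \<times> A. (f x, f y) \<in> r}" (is "tree A ?s")
proof -
  have fD: "f x \<in> D" if "x \<in> A" for x
    using f that bij_betwE by blast
  have finj: "f x = f y \<longleftrightarrow> x = y" if "x \<in> A" "y \<in> A" for x y
    using f that by (auto simp: bij_betw_def inj_on_eq_iff)
  have po: "refl_on D r" "trans r" "antisym r"
    using T by (auto simp: tree_def partial_order_on_def preorder_on_def)
  have "refl_on A ?s" using po(1) fD by (auto simp: refl_on_def)
  moreover have "?s \<subseteq> A \<times> A" by auto
  moreover have "trans ?s" using po(2) by (auto simp: trans_def)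
  moreover have "antisym ?s" using po(3) finj by (auto simp: antisym_def)
  ultimately have "partial_order_on A ?s"
    by (auto simp: partial_order_on_def preorder_on_def)
  moreover have "\<exists>root\<in>A. \<forall>x\<in>A. (root, x) \<in> ?s"
  proof -
    obtain root where root: "root \<in> D" "\<forall>x\<in>D. (root, x) \<in> r"
      using T by (auto simp: tree_def)
    obtain u where "u \<in> A" "f u = root"
      using f root by (metis bij_betw_imp_surj_on imageE)
    then show ?thesis using root fD by (intro bexI[of _ u]) auto
  qed
  moreover have "\<forall>a\<in>A. finite (underS ?s a) \<and> linear_order_on (underS ?s a) (Restr ?s (underS ?s a))"
  proof (intro ballI conjI)
    fix a assume "a \<in> A"
    have fin: "finite (underS r (f a))" and lin: "total_on (underS r (f a)) (Restr r (underS r (f a)))"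
      using T fD \<open>a \<in> A\<close> by (auto simp: tree_def linear_order_on_def)
    have under: "f x \<in> underS r (f a)" if "x \<in> underS ?s a" for x
      using that finj by (auto simp: underS_def)
    have sub: "underS ?s a \<subseteq> A" by (auto simp: underS_def)
    have "inj_on f (underS ?s a)"
      using sub f by (meson bij_betw_def inj_on_subset)
    then show "finite (underS ?s a)"
      using under by (intro inj_on_finite[OF _ _ fin]) auto
    have "total_on (underS ?s a) (Restr ?s (underS ?s a))"
      unfolding total_on_def
    proof (intro ballI impI)
      fix x y assume xy: "x \<in> underS ?s a" "y \<in> underS ?s a" "x \<noteq> y"
      then have "f x \<noteq> f y" using sub finj by blast
      then have "(f x, f y) \<in> r \<or> (f y, f x) \<in> r"
        using lin under xy unfolding total_on_def by blast
      then show "(x, y) \<in> Restr ?s (underS ?s a) \<or> (y, x) \<in> Restr ?s (underS ?s a)"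
        using xy sub by auto
    qed
    moreover have "refl_on (underS ?s a) (Restr ?s (underS ?s a))"
      using \<open>refl_on A ?s\<close> sub by (auto simp: refl_on_def)
    moreover have "trans (Restr ?s (underS ?s a))" "antisym (Restr ?s (underS ?s a))"
      using \<open>trans ?s\<close> \<open>antisym ?s\<close> by (simp_all only: trans_Restr antisym_Restr)
    ultimately show "linear_order_on (underS ?s a) (Restr ?s (underS ?s a))"
      by (auto simp: linear_order_on_def partial_order_on_def preorder_on_def)
  qed
  ultimately show ?thesis
    unfolding tree_def by (intro conjI)
qed

lemma tree_comparable:
  assumes T: "tree D r" and "(x, z) \<in> r" "(y, z) \<in> r"
  shows "(x, y) \<in> r \<or> (y, x) \<in> r"
proof -
  have z: "z \<in> D" "refl_on D r"
    using T assms by (auto simp: tree_def partial_order_on_def preorder_on_def)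
  show ?thesis
  proof (cases "x = z \<or> y = z \<or> x = y")
    case True
    have "(z, z) \<in> r" "(x, x) \<in> r"
      using z T assms by (auto simp: tree_def partial_order_on_def preorder_on_def refl_on_def)
    then show ?thesis using True assms by auto
  next
    case False
    then have "x \<in> underS r z" "y \<in> underS r z"
      using assms by (auto simp: underS_def)
    moreover have "total_on (underS r z) (Restr r (underS r z))"
      using T z by (auto simp: tree_def linear_order_on_def)
    ultimately show ?thesis
      using False unfolding total_on_def by blast
  qed
qed

text \<open>Take an immediate successor \<open>b\<close> outside the finite set of all
  \<open>d < m\<close> and their predecessors, so that \<open>b\<close> is below no such
  \<open>d\<close>. If \<open>d\<close> is below \<open>b\<close> but not below \<open>a\<close>,
  then comparability puts it strictly above \<open>a\<close>, and immediacy forces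
  \<open>d = b\<close>, which is excluded.\<close>

lemma incomparable_above:
  assumes T: "tree D r" and inf: "infinite (immediate_successors r a)"
  shows "\<exists>b. (a, b) \<in> r \<and> (b, a) \<notin> r \<and> (\<forall>d<m::nat. (d, a) \<in> r \<or> (d, b) \<notin> r \<and> (b, d) \<notin> r)"
proof -
  have po: "refl_on D r" "trans r" "antisym r" "r \<subseteq> D \<times> D"
    using T by (auto simp: tree_def partial_order_on_def preorder_on_def)
  let ?X = "\<Union>d\<in>{..<m} \<inter> D. insert d (underS r d)"
  have "finite ?X"
    using T by (auto simp: tree_def)
  then obtain b where b: "b \<in> immediate_successors r a" "b \<notin> ?X"
    using inf by (metis finite_subset subsetI)
  have ab: "(a, b) \<in> r" "a \<noteq> b" and nb: "\<And>c. \<lbrakk>(a, c) \<in> r; a \<noteq> c; (c, b) \<in> r\<rbrakk> \<Longrightarrow> c = b"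
    using b(1) by (auto simp: immediate_successors_def)
  have "(d, b) \<notin> r \<and> (b, d) \<notin> r" if d: "d < m" "(d, a) \<notin> r" for d
  proof
    show "(b, d) \<notin> r"
    proof
      assume "(b, d) \<in> r"
      moreover from this have "d \<in> D" using po by auto
      ultimately show False using b(2) d by (auto simp: underS_def)
    qed
    show "(d, b) \<notin> r"
    proof
      assume db: "(d, b) \<in> r"
      then have "(a, d) \<in> r" "a \<noteq> d"
        using tree_comparable[OF T db ab(1)] d po by (auto simp: refl_on_def)
      then have "d = b" using nb db by blast
      then show False using b(2) d db po by auto
    qed
  qed
  moreover have "(b, a) \<notin> r" using ab po by (auto simp: antisym_def)
  ultimately show ?thesis using ab by blast
qed

section \<open>The computable antichain and the resulting presentation\<close>

theorem theorem5p1: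
  fixes D :: "nat set" and r :: "nat rel"
  assumes "computable_tree D r"
    and "\<exists>a\<in>D. infinite (immediate_successors r a)"
  shows "\<exists>s :: nat rel. punctual_presentation s D r"
proof -
  have T: "tree D r" and "computable_rel r"
    using assms(1) by (auto simp: computable_tree_def)
  then have "rec_fun (Suc (Suc 0)) (\<lambda>xs. of_bool ((xs ! 0, xs ! 1) \<in> r))"
    unfolding rec_fun_def computable_rel_def numeral_2_eq_2
    by (auto simp: length_Suc_conv)
  note r_rec = TR.comp2[OF this]
  have po: "refl_on D r" "trans r" "antisym r" "r \<subseteq> D \<times> D"
    using T by (auto simp: tree_def partial_order_on_def preorder_on_def)
  obtain a where a: "a \<in> D" "infinite (immediate_successors r a)"
    using assms(2) by blast
  define N where "N m = (LEAST b. (a, b) \<in> r \<and> (b, a) \<notin> r \<and>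
    (\<forall>d<m. (d, a) \<in> r \<or> (d, b) \<notin> r \<and> (b, d) \<notin> r))" for m
  have N: "(a, N m) \<in> r" "(N m, a) \<notin> r"
    and N_inc: "\<And>d. \<lbrakk>d < m; (d, a) \<notin> r\<rbrakk> \<Longrightarrow> (d, N m) \<notin> r \<and> (N m, d) \<notin> r" for m
    using LeastI_ex[OF incomparable_above[OF T a(2), of m]] unfolding N_def by blast+
  \<comment> \<open>Otherwise \<open>N_inc\<close> would apply to \<open>d = N m\<close> and make
    this node incomparable to itself.\<close>
  have N_ge: "m \<le> N m" for m
    using N[of m] N_inc[of "N m" m] po by (auto simp: refl_on_def not_less[symmetric])
  have "rec_fun (Suc 0) (\<lambda>xs. N (xs ! 0))"
    unfolding N_def
    by (intro rec_fun_Least TR.not TR.conj TR.all_less TR.disj r_rec TR.const TR.proj TR.proj_tl TR.proj_tl_tl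
        incomparable_above[OF T a(2)]) auto
  note N_rec = TR.comp1[OF this]
  \<comment> \<open>With the bound \<open>Suc v\<close> the next element avoids \<open>v\<close>
    itself and all smaller numbers not below \<open>a\<close>.\<close>
  define J where "J i = rec_nat (N 0) (\<lambda>i v. N (Suc v)) i" for i
  have "rec_fun (Suc 0) (\<lambda>xs. J (xs ! 0))"
    unfolding J_def by (intro TR.rec N_rec TR.Suc TR.const TR.proj) auto
  note J_rec = TR.comp1[OF this]
  have J_0: "J 0 = N 0" and J_Suc: "J (Suc i) = N (Suc (J i))" for i
    by (simp_all add: J_def)
  have "J i < J (Suc i)" for i
    using N_ge[of "Suc (J i)"] J_Suc by simp
  then have J_mono: "strict_mono J" by (simp add: strict_mono_Suc_iff)
  then have J_ge: "i \<le> J i" for i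
    by (rule strict_mono_imp_increasing)
  have J: "(a, J i) \<in> r" "(J i, a) \<notin> r" for i
    using N J_0 J_Suc by (cases i; simp)+
  have J_inc: "(d, J k) \<notin> r \<and> (J k, d) \<notin> r" if "d \<le> J i" "i < k" "(d, a) \<notin> r" for d i k
  proof -
    obtain l where l: "k = Suc l" "i \<le> l" using \<open>i < k\<close> by (cases k) auto
    then have "d < Suc (J l)"
      using that(1) J_mono by (meson le_trans less_Suc_eq_le strict_mono_less_eq)
    then show ?thesis using N_inc that(3) l J_Suc by simp
  qed
  \<comment> \<open>No \<open>J i\<close> is below \<open>a\<close>, so \<open>J_inc\<close> applies
    to the antichain elements themselves.\<close>
  have J_iff: "(J i, J k) \<in> r \<longleftrightarrow> i = k" for i k
    using J_inc[of "J i" i k] J_inc[of "J k" k i] J po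
    by (metis SigmaD2 in_mono linorder_neqE_nat order_refl refl_onD)
  have J_less: "(d, J i) \<in> r \<longleftrightarrow> (d, a) \<in> r" "(J i, d) \<notin> r" if "d < i" for d i
  proof -
    obtain l where l: "i = Suc l" "d \<le> J l"
      using \<open>d < i\<close> J_ge by (cases i) (auto simp: less_Suc_eq_le intro: le_trans)
    \<comment> \<open>This settles nodes not below \<open>a\<close>. A node below \<open>a\<close>
      is below \<open>J i\<close> by transitivity, and \<open>J i\<close> below it would put
      \<open>J i\<close> below \<open>a\<close>.\<close>
    have *: "(d, J i) \<notin> r \<and> (J i, d) \<notin> r" if "(d, a) \<notin> r"
      using J_inc[OF l(2), of i] l that by simp
    then show "(d, J i) \<in> r \<longleftrightarrow> (d, a) \<in> r" "(J i, d) \<notin> r"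
      using J po(2) by (blast dest: transD)+
  qed
  define E where "E = D - range J"
  have J_notin: "J i \<notin> E" for i
    by (simp add: E_def)
  \<comment> \<open>Decidability of \<open>E\<close>: reflexivity detects the domain, and
    \<open>i \<le> J i\<close> bounds the search for an index.\<close>
  have E_iff: "d \<in> E \<longleftrightarrow> (d, d) \<in> r \<and> (\<forall>i<Suc d. J i \<noteq> d)" for d
    unfolding E_def using po J_ge by (auto simp: refl_on_def less_Suc_eq_le)
  have E_rec: "rec_fun 1 (\<lambda>xs. of_bool (xs ! 0 \<in> E))"
    unfolding E_iff One_nat_def
    by (intro TR.conj TR.all_less TR.not TR.eq J_rec r_rec TR.Suc TR.proj TR.proj_tl) auto
  have "infinite (range J)"
    using J_mono by (simp add: finite_image_iff strict_mono_imp_inj_on)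
  then have E_inf: "infinite (- E)"
    by (rule infinite_super[rotated]) (auto simp: E_def)
  define V where "V c = (if even c then J (c div 2) else c div 2)" for c
  have "rec_fun (Suc 0) (\<lambda>xs. V (xs ! 0))"
    unfolding V_def even_iff_mod_2_eq_zero
    by (intro TR.if TR.eq TR.const TR.mod2 TR.div2 J_rec TR.proj) auto
  note V_rec = TR.comp1[OF this]
  have VR: "rec_fun 2 (\<lambda>xs. of_bool ((V (xs ! 0), V (xs ! 1)) \<in> r))"
    by (intro r_rec V_rec TR.proj) auto
  have V_bij: "bij_betw V {c. even c \<or> c div 2 \<in> E} D"
  proof (rule bij_betwI')
    fix c c' assume c: "c \<in> {c. even c \<or> c div 2 \<in> E}" "c' \<in> {c. even c \<or> c div 2 \<in> E}"
    show "V c = V c' \<longleftrightarrow> c = c'"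
    proof
      assume eq: "V c = V c'"
      then have "even c = even c'"
        using c J_notin by (metis (mono_tags, lifting) V_def mem_Collect_eq)
      moreover from this eq have "c div 2 = c' div 2"
        using J_mono by (auto simp: V_def strict_mono_eq split: if_splits)
      ultimately show "c = c'"
        by (metis even_two_times_div_two odd_two_times_div_two_succ)
    qed simp
  next
    fix c assume "c \<in> {c. even c \<or> c div 2 \<in> E}"
    then show "V c \<in> D"
      using J po(4) by (auto simp: V_def E_def)
  next
    fix d assume "d \<in> D"
    show "\<exists>c\<in>{c. even c \<or> c div 2 \<in> E}. d = V c"
    proof (cases "d \<in> E")
      case True
      then show ?thesis by (intro bexI[of _ "2 * d + 1"]) (auto simp: V_def)
    next
      case False
      then obtain i where "d = J i" using \<open>d \<in> D\<close> by (auto simp: E_def)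
      then show ?thesis by (intro bexI[of _ "2 * i"]) (auto simp: V_def)
    qed
  qed
  \<comment> \<open>The odd codes of the nodes below or equal to \<open>a\<close>: exactly these lie
    below all late fillers.\<close>
  define B where "B = (\<lambda>d. 2 * d + 1) ` {d. (d, a) \<in> r}"
  have "{d. (d, a) \<in> r} \<subseteq> insert a (underS r a)"
    by (auto simp: underS_def)
  moreover have "finite (underS r a)" using T a by (auto simp: tree_def)
  ultimately have B: "finite B" "\<And>b. b \<in> B \<Longrightarrow> odd b"
    unfolding B_def by (auto intro: finite_subset)
  have B_iff: "c \<in> B \<longleftrightarrow> (c div 2, a) \<in> r" if "odd c" for c
    using that by (auto simp: B_def image_iff elim!: oddE)
  have "\<exists>e. bij_betw e UNIV {c. even c \<or> c div 2 \<in> E} \<and>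
    prim_rec_rel {(x, y). (V (e x), V (e y)) \<in> r}"
  proof (rule prim_rec_numbering[OF VR E_rec E_inf B])
    fix c c' :: nat
    show "(V c, V c') \<in> r \<longleftrightarrow> c = c'" if "even c" "even c'"
      using that J_iff by (auto simp: V_def elim!: evenE)
    \<comment> \<open>For \<open>c = 2 * d + 1\<close> and \<open>c' = 2 * i\<close> the order of
      the codes gives \<open>d < i\<close>, as \<open>J_less\<close> requires; likewise in the last
      case.\<close>
    show "(V c, V c') \<in> r \<longleftrightarrow> c \<in> B" if "odd c" "c div 2 \<in> E" "even c'" "c < c'"
      using that J_less(1)[of "c div 2" "c' div 2"] B_iff by (auto simp: V_def elim!: evenE oddE)
    show "(V c, V c') \<notin> r" if "even c" "odd c'" "c' div 2 \<in> E" "c' < c"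
      using that J_less(2)[of "c' div 2" "c div 2"] by (auto simp: V_def elim!: evenE oddE)
  qed
  then obtain e where e: "bij_betw e UNIV {c. even c \<or> c div 2 \<in> E}"
    and e_rec: "prim_rec_rel {(x, y). (V (e x), V (e y)) \<in> r}"
    by blast
  have Ve: "bij_betw (V \<circ> e) UNIV D"
    using e V_bij by (rule bij_betw_trans)
  let ?s = "{(x, y). (V (e x), V (e y)) \<in> r}"
  have "tree UNIV ?s"
    using tree_inv_image[OF T Ve] by simp
  moreover have "order_isomorphic UNIV ?s D r"
    unfolding order_isomorphic_def using Ve by (intro exI[of _ "V \<circ> e"]) auto
  ultimately show ?thesis
    unfolding punctual_presentation_def using e_rec by blast
qed

end
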